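(* $WO^1$ is HPL-independent of $choice_h$; that is, there is a Henkin–Asser structure which is a model of $choice_h\cup\{WO^1\}$ and there is a Henkin–Asser structure which is a model of $choice_h\cup\{\neg WO^1\}$, so that neither $WO^1$ nor $\neg WO^1$ follows from ${}^hax^{(2)}\cup choice_h$ in HPL.
   Context: The metatheory is ZFC, assumed consistent. Second-order predicate logic with Henkin semantics (HPL): for a nonempty set $I$, ${\rm pred}_k(I)$ is the set of maps $I^k\to\{true,false\}$; a predicate structure is $(J_k)_{k\ge0}$ with $J_0=I$ and $\emptyset\ne J_k\subseteq{\rm pred}_k(I)$, $k$-ary predicate quantifiers ranging over $J_k$. A structure is a model of a set of formulas if each is true under every assignment. ${}^hax^{(2)}$ is the set of comprehension axioms $\exists A\forall\mathbf x(A\mathbf x\leftrightarrow G)$ ($G$ any formula with $A$ not free, $\mathbf x$ a tuple of distinct individual variables); Henkin–Asser structures are the predicate structures that are models of ${}^hax^{(2)}$, and a formula follows in HPL from a set $\Phi$ if it is true in every Henkin–Asser structure that is a model of $\Phi$. $choice_h=\bigcup_{n,m\ge1}choice_h^{n,m}$, where $choice_h^{n,m}$ is the set of all formulas $\forall\mathbf x\exists D\,H(\mathbf x,D)\to\exists S\forall\mathbf x\exists D\big(\forall\mathbf y(D\mathbf y\leftrightarrow S\mathbf x\mathbf y)\land H(\mathbf x,D)\big)$, with $H$ any second-order formula, $\mathbf x$ an $n$-tuple and $\mathbf y$ an $m$-tuple of distinct individual variables, $D$ an $m$-ary and $S$ an $(n+m)$-ary predicate variable, $\mathbf y$ and $S$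 not occurring in $H$. $WO^1=\forall A\exists T\,wo(T,A)$ ($A$ unary, $T$ binary), where $wo(T,A)$ states that $T$ is a reflexive, antisymmetric, transitive relation on $A$, total on $A$, and every nonempty $B$ with $\forall x(Bx\to Ax)$ has an element $x_0$ with $\forall x_1(Bx_1\to Tx_0x_1)$. *)

theory Defs
  imports Main "HOL-Library.FuncSet"
begin

section \<open>Second-order formulas\<close>

type_synonym ivar = nat

text \<open>A predicate variable is a pair (arity, index); only arities \<open>\<ge> 1\<close> are admitted, see \<open>wff\<close>.\<close>

type_synonym pvar = "nat \<times> nat"

datatype fm =
    FEq ivar ivar            (infix "\<^bold>=" 60)
  | App pvar "ivar list"
  | Neg fm                   ("\<^bold>\<not> _" [58] 58)
  | Conj fm fm               (infixr "\<^bold>\<and>" 55)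
  | Disj fm fm               (infixr "\<^bold>\<or>" 54)
  | Imp fm fm                (infixr "\<^bold>\<longrightarrow>" 53)
  | Iff fm fm                (infix "\<^bold>\<longleftrightarrow>" 52)
  | FAll ivar fm
  | FEx ivar fm
  | PAll pvar fm
  | PEx pvar fm

fun wff :: "fm \<Rightarrow> bool" where
  "wff (x \<^bold>= y) \<longleftrightarrow> True"
| "wff (App A xs) \<longleftrightarrow> fst A \<ge> 1 \<and> length xs = fst A"
| "wff (\<^bold>\<not> F) \<longleftrightarrow> wff F"
| "wff (F \<^bold>\<and> G) \<longleftrightarrow> wff F \<and> wff G"
| "wff (F \<^bold>\<or> G) \<longleftrightarrow> wff F \<and> wff G"
| "wff (F \<^bold>\<longrightarrow> G) \<longleftrightarrow> wff F \<and> wff G"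
| "wff (F \<^bold>\<longleftrightarrow> G) \<longleftrightarrow> wff F \<and> wff G"
| "wff (FAll x F) \<longleftrightarrow> wff F"
| "wff (FEx x F) \<longleftrightarrow> wff F"
| "wff (PAll A F) \<longleftrightarrow> fst A \<ge> 1 \<and> wff F"
| "wff (PEx A F) \<longleftrightarrow> fst A \<ge> 1 \<and> wff F"

text \<open>All individual variables occurring in a formula, free or bound (including the variable of a
  quantifier prefix).\<close>

fun ivars :: "fm \<Rightarrow> ivar set" where
  "ivars (x \<^bold>= y) = {x, y}"
| "ivars (App A xs) = set xs"
| "ivars (\<^bold>\<not> F) = ivars F"
| "ivars (F \<^bold>\<and> G) = ivars F \<union> ivars G"
| "ivars (F \<^bold>\<or> G) = ivars F \<union> ivars G"
| "ivars (F \<^bold>\<longrightarrow> G) = ivars F \<union> ivars G"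
| "ivars (F \<^bold>\<longleftrightarrow> G) = ivars F \<union> ivars G"
| "ivars (FAll x F) = insert x (ivars F)"
| "ivars (FEx x F) = insert x (ivars F)"
| "ivars (PAll A F) = ivars F"
| "ivars (PEx A F) = ivars F"

text \<open>Likewise for predicate variables.\<close>

fun pvars :: "fm \<Rightarrow> pvar set" where
  "pvars (x \<^bold>= y) = {}"
| "pvars (App A xs) = {A}"
| "pvars (\<^bold>\<not> F) = pvars F"
| "pvars (F \<^bold>\<and> G) = pvars F \<union> pvars G"
| "pvars (F \<^bold>\<or> G) = pvars F \<union> pvars G"
| "pvars (F \<^bold>\<longrightarrow> G) = pvars F \<union> pvars G"
| "pvars (F \<^bold>\<longleftrightarrow> G) = pvars F \<union> pvars G"
| "pvars (FAll x F) = pvars F"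
| "pvars (FEx x F) = pvars F"
| "pvars (PAll A F) = insert A (pvars F)"
| "pvars (PEx A F) = insert A (pvars F)"

fun free_pvars :: "fm \<Rightarrow> pvar set" where
  "free_pvars (x \<^bold>= y) = {}"
| "free_pvars (App A xs) = {A}"
| "free_pvars (\<^bold>\<not> F) = free_pvars F"
| "free_pvars (F \<^bold>\<and> G) = free_pvars F \<union> free_pvars G"
| "free_pvars (F \<^bold>\<or> G) = free_pvars F \<union> free_pvars G"
| "free_pvars (F \<^bold>\<longrightarrow> G) = free_pvars F \<union> free_pvars G"
| "free_pvars (F \<^bold>\<longleftrightarrow> G) = free_pvars F \<union> free_pvars G"
| "free_pvars (FAll x F) = free_pvars F"
| "free_pvars (FEx x F) = free_pvars F"
| "free_pvars (PAll A F) = free_pvars F - {A}"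
| "free_pvars (PEx A F) = free_pvars F - {A}"

abbreviation FAlls :: "ivar list \<Rightarrow> fm \<Rightarrow> fm" where
  "FAlls xs F \<equiv> foldr FAll xs F"


section \<open>Henkin semantics\<close>

definition tuples :: "nat \<Rightarrow> 'a set \<Rightarrow> 'a list set" where
  "tuples k I = {as. length as = k \<and> set as \<subseteq> I}"

text \<open>The maps from \<open>I\<^sup>k\<close> to the truth values, rendered as extensional functions, so that two
  predicates that agree on \<open>I\<^sup>k\<close> are equal.\<close>

definition pred :: "nat \<Rightarrow> 'a set \<Rightarrow> ('a list \<Rightarrow> bool) set" where
  "pred k I = tuples k I \<rightarrow>\<^sub>E UNIV"

text \<open>The component \<open>J\<^sub>0 = I\<close> of a predicate structure is \<open>indivs M\<close>; \<open>J\<^sub>k\<close> is \<open>rels M k\<close> for \<open>k \<ge> 1\<close>.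
  The value \<open>rels M 0\<close> plays no role.\<close>

record 'a pstruct =
  indivs :: "'a set"
  rels :: "nat \<Rightarrow> ('a list \<Rightarrow> bool) set"

definition predicate_structure :: "'a pstruct \<Rightarrow> bool" where
  "predicate_structure M \<longleftrightarrow>
     indivs M \<noteq> {} \<and> (\<forall>k\<ge>1. rels M k \<noteq> {} \<and> rels M k \<subseteq> pred k (indivs M))"

fun holds :: "'a pstruct \<Rightarrow> (ivar \<Rightarrow> 'a) \<Rightarrow> (pvar \<Rightarrow> 'a list \<Rightarrow> bool) \<Rightarrow> fm \<Rightarrow> bool" where
  "holds M e P (x \<^bold>= y) \<longleftrightarrow> e x = e y"
| "holds M e P (App A xs) \<longleftrightarrow> P A (map e xs)"
| "holds M e P (\<^bold>\<not> F) \<longleftrightarrow> \<not> holds M e P F"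
| "holds M e P (F \<^bold>\<and> G) \<longleftrightarrow> holds M e P F \<and> holds M e P G"
| "holds M e P (F \<^bold>\<or> G) \<longleftrightarrow> holds M e P F \<or> holds M e P G"
| "holds M e P (F \<^bold>\<longrightarrow> G) \<longleftrightarrow> (holds M e P F \<longrightarrow> holds M e P G)"
| "holds M e P (F \<^bold>\<longleftrightarrow> G) \<longleftrightarrow> (holds M e P F \<longleftrightarrow> holds M e P G)"
| "holds M e P (FAll x F) \<longleftrightarrow> (\<forall>a\<in>indivs M. holds M (e(x := a)) P F)"
| "holds M e P (FEx x F) \<longleftrightarrow> (\<exists>a\<in>indivs M. holds M (e(x := a)) P F)"
| "holds M e P (PAll A F) \<longleftrightarrow> (\<forall>p\<in>rels M (fst A). holds M e (P(A := p)) F)"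
| "holds M e P (PEx A F) \<longleftrightarrow> (\<exists>p\<in>rels M (fst A). holds M e (P(A := p)) F)"

definition assignment :: "'a pstruct \<Rightarrow> (ivar \<Rightarrow> 'a) \<Rightarrow> (pvar \<Rightarrow> 'a list \<Rightarrow> bool) \<Rightarrow> bool" where
  "assignment M e P \<longleftrightarrow>
     (\<forall>x. e x \<in> indivs M) \<and> (\<forall>A. fst A \<ge> 1 \<longrightarrow> P A \<in> rels M (fst A))"

definition true_in :: "'a pstruct \<Rightarrow> fm \<Rightarrow> bool" where
  "true_in M F \<longleftrightarrow> (\<forall>e P. assignment M e P \<longrightarrow> holds M e P F)"

definition model_of :: "'a pstruct \<Rightarrow> fm set \<Rightarrow> bool" where
  "model_of M \<Phi> \<longleftrightarrow> (\<forall>F\<in>\<Phi>. true_in M F)"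

definition comprehension :: "fm set" where
  "comprehension =
     {PEx A (FAlls xs (App A xs \<^bold>\<longleftrightarrow> G)) | A xs G.
        wff G \<and> fst A \<ge> 1 \<and> length xs = fst A \<and> distinct xs \<and> A \<notin> free_pvars G}"

definition henkin_asser :: "'a pstruct \<Rightarrow> bool" where
  "henkin_asser M \<longleftrightarrow> predicate_structure M \<and> model_of M comprehension"

text \<open>HOL cannot quantify over structures of all types inside a formula; the type argument fixes
  the type from which the domains of individuals are taken (as arbitrary nonempty subsets).\<close>

definition follows_HPL :: "'a itself \<Rightarrow> fm set \<Rightarrow> fm \<Rightarrow> bool" where
  "follows_HPL _ \<Phi> F \<longleftrightarrow>
     (\<forall>M :: 'a pstruct. henkin_asser M \<and> model_of M \<Phi> \<longrightarrow> true_in M F)"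


section \<open>Choice and well-ordering\<close>

definition choice_h_nm :: "nat \<Rightarrow> nat \<Rightarrow> fm set" where
  "choice_h_nm n m =
     {FAlls xs (PEx D H) \<^bold>\<longrightarrow>
        PEx S (FAlls xs (PEx D (FAlls ys (App D ys \<^bold>\<longleftrightarrow> App S (xs @ ys)) \<^bold>\<and> H))) | xs ys D S H.
        wff H \<and> length xs = n \<and> length ys = m \<and> distinct (xs @ ys) \<and>
        fst D = m \<and> fst S = n + m \<and> set ys \<inter> ivars H = {} \<and> S \<notin> pvars H}"

definition choice_h :: "fm set" where
  "choice_h = (\<Union>n\<in>{1..}. \<Union>m\<in>{1..}. choice_h_nm n m)"

text \<open>\<open>T\<close> binary, \<open>A\<close> unary. The first conjunct says that \<open>T\<close> is a relation on \<open>A\<close>; in the last one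
  the index of the bound variable \<open>B\<close> is chosen so that \<open>B \<noteq> A\<close>.\<close>

definition wo :: "pvar \<Rightarrow> pvar \<Rightarrow> fm" where
  "wo T A = (let B = (1, Suc (snd A)) in
     FAlls [0,1] (App T [0,1] \<^bold>\<longrightarrow> App A [0] \<^bold>\<and> App A [1]) \<^bold>\<and>
     FAll 0 (App A [0] \<^bold>\<longrightarrow> App T [0,0]) \<^bold>\<and>
     FAlls [0,1] (App A [0] \<^bold>\<and> App A [1] \<^bold>\<longrightarrow> App T [0,1] \<^bold>\<and> App T [1,0] \<^bold>\<longrightarrow> 0 \<^bold>= 1) \<^bold>\<and>
     FAlls [0,1,2] (App A [0] \<^bold>\<and> App A [1] \<^bold>\<and> App A [2] \<^bold>\<longrightarrow>
       App T [0,1] \<^bold>\<and> App T [1,2] \<^bold>\<longrightarrow> App T [0,2]) \<^bold>\<and>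
     FAlls [0,1] (App A [0] \<^bold>\<and> App A [1] \<^bold>\<longrightarrow> App T [0,1] \<^bold>\<or> App T [1,0]) \<^bold>\<and>
     PAll B (FEx 0 (App B [0]) \<^bold>\<and> FAll 0 (App B [0] \<^bold>\<longrightarrow> App A [0]) \<^bold>\<longrightarrow>
       FEx 0 (App B [0] \<^bold>\<and> FAll 1 (App B [1] \<^bold>\<longrightarrow> App T [0,1]))))"

definition WO1 :: fm where
  "WO1 = PAll (1,0) (PEx (2,0) (wo (2,0) (1,0)))"

end

theory Submission
  imports Defs "HOL-Combinatorics.Transposition"
begin

text \<open>The full structure satisfies both \<open>choice_h\<close> and \<open>WO1\<close>. For \<open>\<not> WO1\<close>, keep only the relations
  that are invariant under all permutations fixing some finite set pointwise (the basic Fraenkel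
  model). A transposition of two individuals outside a finite support destroys every linear order.
  For \<open>choice_h\<close>, suppose \<open>H\<close> has support \<open>E\<close>. The \<open>n\<close>-tuples form finitely many orbits under the
  permutations fixing \<open>E\<close>, so the predicates \<open>D\<close> with \<open>H(x,D)\<close> can be taken with supports of bounded
  size. Hence, for a sufficiently large finite set \<open>G\<close>, a permutation fixing \<open>E\<close> and \<open>x\<close> moves such a
  support into \<open>E \<union> G \<union> x\<close>. Choosing \<open>D\<close> for one representative of each orbit under the
  permutations fixing \<open>E \<union> G\<close>, and transporting it along the orbit, yields a choice relation \<open>S\<close>
  supported by \<open>E \<union> G\<close>.\<close>

section \<open>Iterated quantifiers\<close>

text \<open>The head is updated first, so on repeated variables the last entry wins, just as the
  innermost quantifier does in \<open>FAlls\<close>.\<close>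

fun upds :: "('b \<Rightarrow> 'a) \<Rightarrow> 'b list \<Rightarrow> 'a list \<Rightarrow> 'b \<Rightarrow> 'a" where
  "upds e (x # xs) (a # as) = upds (e(x := a)) xs as"
| "upds e _ _ = e"

lemma upds_notin: "y \<notin> set xs \<Longrightarrow> upds e xs as y = e y"
  by (induction e xs as rule: upds.induct) auto

lemma map_upds_same:
  assumes "distinct xs" and "length as = length xs"
  shows "map (upds e xs as) xs = as"
  using assms by (induction e xs as rule: upds.induct) (auto simp: upds_notin)

text \<open>A variable listed in \<open>xs\<close> takes its value from the tuple alone, so the base
  environments may differ.\<close>

lemma upds_map:
  "length as = length xs \<Longrightarrow> y \<in> set xs \<Longrightarrow> upds e' xs (map f as) y = f (upds e xs as y)"
proof (induction xs as arbitrary: e e' rule: list_induct2')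
  case (4 x xs a as)
  then show ?case by (cases "y \<in> set xs") (auto simp: upds_notin)
qed auto

lemma map_upds_disjoint: "set ys \<inter> set xs = {} \<Longrightarrow> map (upds e xs as) ys = map e ys"
  by (auto intro!: upds_notin)

lemma holds_FAlls:
  "holds M e P (FAlls xs F) \<longleftrightarrow>
     (\<forall>as\<in>tuples (length xs) (indivs M). holds M (upds e xs as) P F)"
proof (induction xs arbitrary: e)
  case Nil
  show ?case by (simp add: tuples_def)
next
  case (Cons x xs)
  have "(\<forall>as\<in>tuples (length (x # xs)) (indivs M). Q as) \<longleftrightarrow>
      (\<forall>a\<in>indivs M. \<forall>as\<in>tuples (length xs) (indivs M). Q (a # as))" for Q
    by (auto simp: tuples_def length_Suc_conv)
  with Cons show ?case by (simp add: fun_upd_def)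
qed

lemma finite_ivars: "finite (ivars F)"
  by (induction F) auto

lemma finite_free_pvars: "finite (free_pvars F)"
  by (induction F) auto

lemma free_pvars_subset_pvars: "free_pvars F \<subseteq> pvars F"
  by (induction F) auto

lemma wff_free_pvars: "wff F \<Longrightarrow> A \<in> free_pvars F \<Longrightarrow> fst A \<ge> 1"
  by (induction F) auto


section \<open>Permutations acting on predicates\<close>

text \<open>The image of the relation \<open>p\<close> under \<open>\<pi>\<close>; the inverse
  appears because a predicate is a function of its arguments.\<close>

definition act :: "('a \<Rightarrow> 'a) \<Rightarrow> ('a list \<Rightarrow> bool) \<Rightarrow> 'a list \<Rightarrow> bool" where
  "act \<pi> p as = p (map (inv \<pi>) as)"

lemma map_inv_map: "bij \<pi> \<Longrightarrow> map (inv \<pi>) (map \<pi> as) = as"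
  by (simp add: bij_is_inj)

lemma map_map_inv: "bij \<pi> \<Longrightarrow> map \<pi> (map (inv \<pi>) as) = as"
  by (simp add: bij_is_surj surj_f_inv_f map_idI)

lemma act_map: "bij \<pi> \<Longrightarrow> act \<pi> p (map \<pi> as) = p as"
  by (simp only: act_def map_inv_map)

lemma act_act_inv: "bij \<pi> \<Longrightarrow> act \<pi> (act (inv \<pi>) p) = p"
  by (rule ext) (simp only: act_def inv_inv_eq map_map_inv)

lemma act_id: "act id p = p"
  by (rule ext) (simp add: act_def)

lemma act_pred: "p \<in> pred k UNIV \<Longrightarrow> act \<pi> p \<in> pred k UNIV"
  by (auto simp: pred_def tuples_def act_def PiE_def extensional_def)

text \<open>A permutation under which the predicate domains are closed in both directions is an
  automorphism of the structure, hence preserves truth. Agreement is demanded only on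
  \<open>ivars F\<close> and \<open>free_pvars F\<close>, so that the identity permutation yields
  the coincidence property.\<close>

lemma holds_act:
  assumes M: "indivs M = UNIV" and \<pi>: "bij \<pi>"
    and cl: "\<And>k p. p \<in> rels M k \<Longrightarrow> act \<pi> p \<in> rels M k"
    and cl': "\<And>k p. p \<in> rels M k \<Longrightarrow> act (inv \<pi>) p \<in> rels M k"
    and e: "\<And>x. x \<in> ivars F \<Longrightarrow> e' x = \<pi> (e x)"
    and P: "\<And>A. A \<in> free_pvars F \<Longrightarrow> P' A = act \<pi> (P A)"
  shows "holds M e' P' F \<longleftrightarrow> holds M e P F"
  using e P
proof (induction F arbitrary: e e' P P')
  case (FEq x y)
  then show ?case using \<pi> by (auto dest: bij_is_inj injD)
next
  case (App A xs)
  have "map e' xs = map \<pi> (map e xs)" using App.prems(1) by simp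
  then show ?case using App.prems(2) by (simp only: holds.simps free_pvars.simps singletonI act_map[OF \<pi>])
next
  case (FAll x F)
  have *: "holds M (e'(x := \<pi> a)) P' F = holds M (e(x := a)) P F" for a
    by (rule FAll.IH) (use FAll.prems in auto)
  have "(\<forall>a. holds M (e'(x := a)) P' F) \<longleftrightarrow> (\<forall>a. holds M (e'(x := \<pi> a)) P' F)"
    using \<pi> by (metis bij_pointE)
  then show ?case by (simp add: M *)
next
  case (FEx x F)
  have *: "holds M (e'(x := \<pi> a)) P' F = holds M (e(x := a)) P F" for a
    by (rule FEx.IH) (use FEx.prems in auto)
  have "(\<exists>a. holds M (e'(x := a)) P' F) \<longleftrightarrow> (\<exists>a. holds M (e'(x := \<pi> a)) P' F)"
    using \<pi> by (metis bij_pointE)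
  then show ?case by (simp add: M *)
next
  case (PAll A F)
  have *: "holds M e' (P'(A := act \<pi> p)) F = holds M e (P(A := p)) F" for p
    by (rule PAll.IH) (use PAll.prems in auto)
  \<comment> \<open>Each \<open>p\<close> in the domain is the image under \<open>act \<pi>\<close>
    of \<open>act (inv \<pi>) p\<close>, which is again in the domain.\<close>
  have "(\<forall>p\<in>rels M (fst A). holds M e' (P'(A := p)) F) \<longleftrightarrow>
      (\<forall>p\<in>rels M (fst A). holds M e' (P'(A := act \<pi> p)) F)"
    using cl cl' act_act_inv[OF \<pi>] by metis
  then show ?case by (simp add: *)
next
  case (PEx A F)
  have *: "holds M e' (P'(A := act \<pi> p)) F = holds M e (P(A := p)) F" for p
    by (rule PEx.IH) (use PEx.prems in auto)
  have "(\<exists>p\<in>rels M (fst A). holds M e' (P'(A := p)) F) \<longleftrightarrow>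
      (\<exists>p\<in>rels M (fst A). holds M e' (P'(A := act \<pi> p)) F)"
    using cl cl' act_act_inv[OF \<pi>] by metis
  then show ?case by (simp add: *)
next
  case (Neg F)
  have "holds M e' P' F = holds M e P F" by (rule Neg.IH) (use Neg.prems in auto)
  then show ?case by simp
next
  case (Conj F G)
  have "holds M e' P' F = holds M e P F" by (rule Conj.IH) (use Conj.prems in auto)
  moreover have "holds M e' P' G = holds M e P G" by (rule Conj.IH) (use Conj.prems in auto)
  ultimately show ?case by simp
next
  case (Disj F G)
  have "holds M e' P' F = holds M e P F" by (rule Disj.IH) (use Disj.prems in auto)
  moreover have "holds M e' P' G = holds M e P G" by (rule Disj.IH) (use Disj.prems in auto)
  ultimately show ?case by simp
next
  case (Imp F G)
  have "holds M e' P' F = holds M e P F" by (rule Imp.IH) (use Imp.prems in auto)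
  moreover have "holds M e' P' G = holds M e P G" by (rule Imp.IH) (use Imp.prems in auto)
  ultimately show ?case by simp
next
  case (Iff F G)
  have "holds M e' P' F = holds M e P F" by (rule Iff.IH) (use Iff.prems in auto)
  moreover have "holds M e' P' G = holds M e P G" by (rule Iff.IH) (use Iff.prems in auto)
  ultimately show ?case by simp
qed

lemma holds_cong:
  assumes "indivs M = UNIV"
    and "\<And>x. x \<in> ivars F \<Longrightarrow> e' x = e x" and "\<And>A. A \<in> free_pvars F \<Longrightarrow> P' A = P A"
  shows "holds M e' P' F \<longleftrightarrow> holds M e P F"
  by (rule holds_act[where \<pi> = id]) (use assms in \<open>auto simp: act_id simp flip: id_def\<close>)


section \<open>Semantic criteria for comprehension and choice\<close>

text \<open>The relation defined by \<open>G\<close> is itself the witness for \<open>A\<close>: as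
  \<open>A\<close> is not free in \<open>G\<close>, assigning it does not disturb \<open>G\<close>.
  What remains is that definable relations belong to the structure.\<close>

lemma model_of_comprehensionI:
  assumes M: "indivs M = UNIV"
    and ex: "\<And>k xs G e P. \<lbrakk>assignment M e P; wff G; k \<ge> 1; length xs = k; distinct xs\<rbrakk> \<Longrightarrow>
      restrict (\<lambda>as. holds M (upds e xs as) P G) (tuples k UNIV) \<in> rels M k"
  shows "model_of M comprehension"
  unfolding model_of_def true_in_def
proof (intro ballI allI impI)
  fix F e P
  assume F: "F \<in> comprehension" and eP: "assignment M e P"
  from F obtain A xs G where G: "F = PEx A (FAlls xs (App A xs \<^bold>\<longleftrightarrow> G))" "wff G" "fst A \<ge> 1"
    "length xs = fst A" "distinct xs" "A \<notin> free_pvars G"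
    unfolding comprehension_def by blast
  define p where "p = restrict (\<lambda>as. holds M (upds e xs as) P G) (tuples (fst A) UNIV)"
  have "p \<in> rels M (fst A)"
    unfolding p_def by (rule ex) (use G eP in auto)
  moreover have "holds M (upds e xs as) (P(A := p)) (App A xs \<^bold>\<longleftrightarrow> G)"
    if "as \<in> tuples (length xs) UNIV" for as
  proof -
    have "holds M (upds e xs as) (P(A := p)) G = holds M (upds e xs as) P G"
      by (rule holds_cong) (use M G in auto)
    moreover have "map (upds e xs as) xs = as"
      using that G by (intro map_upds_same) (auto simp: tuples_def)
    ultimately show ?thesis using that G by (simp add: p_def)
  qed
  ultimately show "holds M e P F"
    unfolding G holds.simps holds_FAlls M by blast
qed

text \<open>Reduces the schema to relations: at each tuple \<open>as\<close>, the section of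
  \<open>s\<close> must satisfy \<open>H\<close>. The syntactic side conditions are dealt with here
  once for both structures.\<close>

lemma model_of_choiceI:
  assumes M: "indivs M = UNIV"
    and ext: "\<And>k. rels M k \<subseteq> pred k UNIV"
    and ex: "\<And>n m D xs H e P. \<lbrakk>assignment M e P; wff H; n \<ge> 1; m \<ge> 1; length xs = n; distinct xs; fst D = m;
      \<And>as. length as = n \<Longrightarrow> \<exists>d\<in>rels M m. holds M (upds e xs as) (P(D := d)) H\<rbrakk> \<Longrightarrow>
      \<exists>s\<in>rels M (n + m). \<forall>as. length as = n \<longrightarrow>
        (\<exists>d\<in>rels M m. (\<forall>bs. length bs = m \<longrightarrow> d bs = s (as @ bs)) \<and>
           holds M (upds e xs as) (P(D := d)) H)"
  shows "model_of M choice_h"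
  unfolding model_of_def true_in_def
proof (intro ballI allI impI)
  fix F e P
  assume F: "F \<in> choice_h" and eP: "assignment M e P"
  from F obtain n m xs ys D S H where F_eq: "F = FAlls xs (PEx D H) \<^bold>\<longrightarrow>
        PEx S (FAlls xs (PEx D (FAlls ys (App D ys \<^bold>\<longleftrightarrow> App S (xs @ ys)) \<^bold>\<and> H)))"
    and nm: "n \<ge> 1" "m \<ge> 1" and H: "wff H" "length xs = n" "length ys = m" "distinct (xs @ ys)"
        "fst D = m" "fst S = n + m" "set ys \<inter> ivars H = {}" "S \<notin> pvars H"
    unfolding choice_h_def choice_h_nm_def by auto
  show "holds M e P F"
    unfolding F_eq holds.simps(6)
  proof
    assume "holds M e P (FAlls xs (PEx D H))"
    then have "\<exists>d\<in>rels M m. holds M (upds e xs as) (P(D := d)) H" if "length as = n" for as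
      using that H by (simp add: holds_FAlls M tuples_def)
    from ex[OF eP H(1) nm H(2) _ H(5) this] H
    obtain s where s: "s \<in> rels M (n + m)" and sd: "\<And>as. length as = n \<Longrightarrow>
        \<exists>d\<in>rels M m. (\<forall>bs. length bs = m \<longrightarrow> d bs = s (as @ bs)) \<and>
           holds M (upds e xs as) (P(D := d)) H"
      by auto
    have "\<exists>d\<in>rels M (fst D). holds M (upds e xs as) (P(S := s, D := d))
        (FAlls ys (App D ys \<^bold>\<longleftrightarrow> App S (xs @ ys)) \<^bold>\<and> H)"
      if as: "as \<in> tuples (length xs) UNIV" for as
    proof -
      have l: "length as = n" using as H by (simp add: tuples_def)
      from sd[OF l] obtain d where d: "d \<in> rels M m" "\<And>bs. length bs = m \<Longrightarrow> d bs = s (as @ bs)"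
          "holds M (upds e xs as) (P(D := d)) H" by blast
      \<comment> \<open>\<open>S\<close> does not occur in \<open>H\<close>, so interpreting it by
        \<open>s\<close> leaves \<open>H\<close> unaffected.\<close>
      have "holds M (upds e xs as) (P(S := s, D := d)) H = holds M (upds e xs as) (P(D := d)) H"
        by (rule holds_cong) (use M H free_pvars_subset_pvars[of H] in auto)
      moreover have "holds M (upds (upds e xs as) ys bs) (P(S := s, D := d)) (App D ys \<^bold>\<longleftrightarrow> App S (xs @ ys))"
        if "length bs = m" for bs
      proof -
        have 1: "map (upds (upds e xs as) ys bs) ys = bs"
          using that H by (intro map_upds_same) auto
        have "map (upds (upds e xs as) ys bs) xs = map (upds e xs as) xs"
          using H by (intro map_upds_disjoint) auto
        also have "\<dots> = as" using l H by (intro map_upds_same) auto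
        finally have 2: "map (upds (upds e xs as) ys bs) xs = as" .
        \<comment> \<open>The arities \<open>n + m\<close> and \<open>m\<close> differ, so the
          update at \<open>D\<close> does not overwrite the one at \<open>S\<close>.\<close>
        have "S \<noteq> D" using H nm by auto
        then show ?thesis by (simp only: holds.simps map_append 1 2) (simp add: d(2) that)
      qed
      ultimately show ?thesis
        unfolding holds.simps(4) holds_FAlls M using d H by (intro bexI[of _ d]) (auto simp: tuples_def)
    qed
    then show "holds M e P (PEx S (FAlls xs (PEx D (FAlls ys (App D ys \<^bold>\<longleftrightarrow> App S (xs @ ys)) \<^bold>\<and> H))))"
      unfolding holds.simps(11) holds_FAlls[of _ _ _ xs] M using s H by auto
  qed
qed

text \<open>The least-element clause ranges over \<open>J\<close> only: this is well-ordering as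
  seen by the structure's own unary predicates.\<close>

definition wo_on :: "('a list \<Rightarrow> bool) set \<Rightarrow> ('a list \<Rightarrow> bool) \<Rightarrow> ('a list \<Rightarrow> bool) \<Rightarrow> bool" where
  "wo_on J t p \<longleftrightarrow>
     (\<forall>a b. t [a, b] \<longrightarrow> p [a] \<and> p [b]) \<and>
     (\<forall>a. p [a] \<longrightarrow> t [a, a]) \<and>
     (\<forall>a b. p [a] \<and> p [b] \<longrightarrow> t [a, b] \<and> t [b, a] \<longrightarrow> a = b) \<and>
     (\<forall>a b c. p [a] \<and> p [b] \<and> p [c] \<longrightarrow> t [a, b] \<and> t [b, c] \<longrightarrow> t [a, c]) \<and>
     (\<forall>a b. p [a] \<and> p [b] \<longrightarrow> t [a, b] \<or> t [b, a]) \<and>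
     (\<forall>q\<in>J. (\<exists>a. q [a]) \<and> (\<forall>a. q [a] \<longrightarrow> p [a]) \<longrightarrow> (\<exists>a. q [a] \<and> (\<forall>b. q [b] \<longrightarrow> t [a, b])))"

lemma holds_WO1:
  assumes "indivs M = UNIV"
  shows "holds M e P WO1 \<longleftrightarrow> (\<forall>p\<in>rels M 1. \<exists>t\<in>rels M 2. wo_on (rels M 1) t p)"
  using assms by (simp add: WO1_def wo_def wo_on_def Let_def)

lemma model_of_union_singleton: "model_of M (\<Phi> \<union> {F}) \<longleftrightarrow> model_of M \<Phi> \<and> true_in M F"
  by (auto simp: model_of_def)

lemma predicate_structure_assignment:
  assumes "predicate_structure M"
  obtains e P where "assignment M e P"
proof -
  obtain a where a: "a \<in> indivs M" using assms by (auto simp: predicate_structure_def)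
  have "\<forall>k. \<exists>p. k \<ge> 1 \<longrightarrow> p \<in> rels M k" using assms by (auto simp: predicate_structure_def)
  then obtain p where "\<forall>k. k \<ge> 1 \<longrightarrow> p k \<in> rels M k" by metis
  with a have "assignment M (\<lambda>_. a) (\<lambda>A. p (fst A))" by (auto simp: assignment_def)
  then show ?thesis by (rule that)
qed

text \<open>Truth in \<open>M\<close> would be vacuous without assignments; one exists because all
  domains are nonempty, and under it \<open>F\<close> fails.\<close>

lemma not_follows_HPL:
  fixes M :: "'a pstruct"
  assumes M: "henkin_asser M" "model_of M \<Phi>" and F: "\<And>e P. \<not> holds M e P F"
  shows "\<not> follows_HPL TYPE('a) (comprehension \<union> \<Phi>) F"
proof
  assume "follows_HPL TYPE('a) (comprehension \<union> \<Phi>) F"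
  moreover have "model_of M (comprehension \<union> \<Phi>)"
    using M by (auto simp: henkin_asser_def model_of_def)
  ultimately have "true_in M F" using M by (auto simp: follows_HPL_def)
  moreover obtain e P where "assignment M e P"
    using M predicate_structure_assignment by (auto simp: henkin_asser_def)
  ultimately show False using F by (auto simp: true_in_def)
qed


section \<open>The full structure\<close>

definition full :: "'a pstruct" where
  "full = \<lparr>indivs = UNIV, rels = (\<lambda>k. pred k UNIV)\<rparr>"

lemma restrict_in_pred: "restrict f (tuples k I) \<in> pred k I"
  by (simp add: pred_def)

lemma henkin_asser_full: "henkin_asser full"
proof -
  have "model_of full comprehension"
    by (rule model_of_comprehensionI) (auto simp: full_def restrict_in_pred)
  moreover have "predicate_structure (full :: 'a pstruct)"
    using restrict_in_pred by (auto simp: full_def predicate_structure_def)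
  ultimately show ?thesis by (simp add: henkin_asser_def)
qed

lemma full_choice: "model_of full choice_h"
proof (rule model_of_choiceI)
  fix n m :: nat and D :: pvar and xs :: "ivar list" and H e and P :: "pvar \<Rightarrow> 'a list \<Rightarrow> bool"
  assume "\<And>as. length as = n \<Longrightarrow> \<exists>d\<in>rels full m. holds full (upds e xs as) (P(D := d)) H"
  then obtain f where f: "\<And>as. length as = n \<Longrightarrow>
      f as \<in> rels full m \<and> holds full (upds e xs as) (P(D := f as)) H"
    by metis
  \<comment> \<open>The first \<open>n\<close> entries select a witness, the remaining
    \<open>m\<close> are its arguments.\<close>
  define s where "s = restrict (\<lambda>cs. f (take n cs) (drop n cs)) (tuples (n + m) UNIV)"
  have "s \<in> rels full (n + m)" by (simp add: full_def s_def restrict_in_pred)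
  moreover have "f as bs = s (as @ bs)" if "length as = n" "length bs = m" for as bs
    using that by (simp add: s_def tuples_def)
  ultimately show "\<exists>s\<in>rels full (n + m). \<forall>as. length as = n \<longrightarrow>
        (\<exists>d\<in>rels full m. (\<forall>bs. length bs = m \<longrightarrow> d bs = s (as @ bs)) \<and>
           holds full (upds e xs as) (P(D := d)) H)"
    using f by blast
qed (auto simp: full_def)

text \<open>The well-ordering theorem of the metatheory supplies \<open>r\<close>; all nonempty
  subsets have least elements, in particular those given by \<open>pred 1 UNIV\<close>.\<close>

lemma holds_full_WO1: "holds full e P WO1"
proof -
  have "\<exists>t\<in>pred 2 UNIV. wo_on (pred 1 UNIV) t p" for p :: "'a list \<Rightarrow> bool"
  proof -
    define A where "A = {a. p [a]}"
    obtain r where r: "well_order_on A r" using well_order_on by blast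
    define t where "t = restrict (\<lambda>as. (as ! 0, as ! 1) \<in> r) (tuples 2 (UNIV :: 'a set))"
    have t: "t [a, b] \<longleftrightarrow> (a, b) \<in> r" for a b by (simp add: t_def tuples_def)
    have lin: "refl_on A r" "r \<subseteq> A \<times> A" "trans r" "antisym r" "total_on A r" and wf: "wf (r - Id)"
      using r by (auto simp: well_order_on_def linear_order_on_def partial_order_on_def preorder_on_def)
    have tot: "(a, b) \<in> r \<or> (b, a) \<in> r" if "a \<in> A" "b \<in> A" for a b
      using lin that by (cases "a = b") (auto simp: refl_on_def total_on_def)
    have least: "\<exists>a\<in>B. \<forall>b\<in>B. (a, b) \<in> r" if B: "B \<subseteq> A" "B \<noteq> {}" for B
    proof -
      \<comment> \<open>A minimal element for \<open>r - Id\<close>; totality turns it into a least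
        one.\<close>
      obtain a where a: "a \<in> B" "\<And>b. (b, a) \<in> r - Id \<Longrightarrow> b \<notin> B"
        using wfE_min[OF wf] B by (metis all_not_in_conv)
      have "(a, b) \<in> r" if "b \<in> B" for b
        using tot[of a b] a that B by (cases "a = b") auto
      then show ?thesis using a by blast
    qed
    have "\<exists>a. q [a] \<and> (\<forall>b. q [b] \<longrightarrow> (a, b) \<in> r)" if "q [a]" "\<forall>a. q [a] \<longrightarrow> p [a]" for q a
      using least[of "{a. q [a]}"] that by (auto simp: A_def)
    then have "wo_on (pred 1 UNIV) t p"
      using lin tot unfolding wo_on_def t
      by (auto simp: A_def refl_on_def antisym_def elim: transE)
    moreover have "t \<in> pred 2 UNIV" by (simp add: t_def restrict_in_pred)
    ultimately show ?thesis by blast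
  qed
  then show ?thesis by (simp add: holds_WO1 full_def)
qed


section \<open>Finitely supported predicates\<close>

definition fixators :: "'a set \<Rightarrow> ('a \<Rightarrow> 'a) set" where
  "fixators E = {\<pi>. bij \<pi> \<and> (\<forall>a\<in>E. \<pi> a = a)}"

definition supports :: "'a set \<Rightarrow> ('a list \<Rightarrow> bool) \<Rightarrow> bool" where
  "supports E p \<longleftrightarrow> (\<forall>\<pi>\<in>fixators E. \<forall>as. p (map \<pi> as) = p as)"

definition fs_pred :: "nat \<Rightarrow> ('a list \<Rightarrow> bool) set" where
  "fs_pred k = {p \<in> pred k UNIV. \<exists>E. finite E \<and> supports E p}"

definition fraenkel :: "'a pstruct" where
  "fraenkel = \<lparr>indivs = UNIV, rels = fs_pred\<rparr>"

lemma fixators_bij: "\<pi> \<in> fixators E \<Longrightarrow> bij \<pi>"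
  by (simp add: fixators_def)

lemma id_fixators: "id \<in> fixators E"
  by (simp add: fixators_def)

lemma fixators_comp: "\<pi> \<in> fixators E \<Longrightarrow> \<sigma> \<in> fixators E \<Longrightarrow> \<pi> \<circ> \<sigma> \<in> fixators E"
  by (auto simp: fixators_def bij_comp)

lemma fixators_inv: "\<pi> \<in> fixators E \<Longrightarrow> inv \<pi> \<in> fixators E"
  by (auto simp: fixators_def bij_imp_bij_inv intro: inv_f_eq bij_is_inj)

lemma fixators_mono: "E \<subseteq> F \<Longrightarrow> fixators F \<subseteq> fixators E"
  by (auto simp: fixators_def)

lemma transpose_fixators: "a \<notin> E \<Longrightarrow> b \<notin> E \<Longrightarrow> transpose a b \<in> fixators E"
  by (auto simp: fixators_def transpose_def)

lemma supports_mono: "supports E p \<Longrightarrow> E \<subseteq> F \<Longrightarrow> supports F p"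
  unfolding supports_def using fixators_mono by blast

lemma supports_act_eq: "supports E p \<Longrightarrow> \<pi> \<in> fixators E \<Longrightarrow> act \<pi> p = p"
  using fixators_inv by (fastforce simp: supports_def act_def)

text \<open>Conjugation: if \<sigma> fixes the image of \<open>E\<close> under \<pi> pointwise, then
  \<open>inv \<pi> \<circ> \<sigma> \<circ> \<pi>\<close> fixes \<open>E\<close> pointwise.\<close>

lemma supports_act:
  assumes p: "supports E p" and \<pi>: "bij \<pi>"
  shows "supports (\<pi> ` E) (act \<pi> p)"
  unfolding supports_def
proof (intro ballI allI)
  fix \<sigma> as
  assume "\<sigma> \<in> fixators (\<pi> ` E)"
  then have "inv \<pi> \<circ> \<sigma> \<circ> \<pi> \<in> fixators E"
    using \<pi> by (auto simp: fixators_def bij_is_inj intro!: bij_comp bij_imp_bij_inv)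
  then have "p (map (inv \<pi> \<circ> \<sigma> \<circ> \<pi>) (map (inv \<pi>) as)) = p (map (inv \<pi>) as)"
    using p by (simp only: supports_def)
  moreover have "map (inv \<pi> \<circ> \<sigma> \<circ> \<pi>) (map (inv \<pi>) as) = map (inv \<pi>) (map \<sigma> as)"
    using \<pi> by (simp add: bij_is_surj surj_f_inv_f)
  ultimately show "act \<pi> p (map \<sigma> as) = act \<pi> p as"
    unfolding act_def by metis
qed

lemma act_fs_pred: "p \<in> fs_pred k \<Longrightarrow> bij \<pi> \<Longrightarrow> act \<pi> p \<in> fs_pred k"
  unfolding fs_pred_def using supports_act act_pred by blast

section \<open>Orbits of tuples, witnesses of bounded support, and choice along orbits\<close>

lemma finite_orbits:
  assumes "infinite (UNIV :: 'a set)" and "finite E"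
  shows "\<exists>R. finite R \<and> (\<forall>as :: 'a list. length as = n \<longrightarrow> (\<exists>r\<in>R. \<exists>\<pi>\<in>fixators E. length r = n \<and> as = map \<pi> r))"
  using assms(2)
proof (induction n arbitrary: E)
  case 0
  show ?case by (rule exI[of _ "{[]}"]) (use id_fixators in auto)
next
  case (Suc n)
  \<comment> \<open>One point \<open>a\<close> represents all points outside \<open>E\<close>: a
    transposition fixing \<open>E\<close> sends any of them to \<open>a\<close>.\<close>
  obtain a where a: "a \<notin> E" using ex_new_if_finite[OF assms(1) Suc.prems] by blast
  \<comment> \<open>The tail is treated with \<open>a\<close> added to the fixed set, so that
    correcting it does not move the head again.\<close>
  obtain R where R: "finite R" "\<And>as. length as = n \<Longrightarrow>
      \<exists>r\<in>R. \<exists>\<pi>\<in>fixators (insert a E). length r = n \<and> as = map \<pi> r"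
    using Suc.IH[of "insert a E"] Suc.prems by auto
  let ?R = "(\<lambda>(b, r). b # r) ` (insert a E \<times> R)"
  have "\<exists>r\<in>?R. \<exists>\<pi>\<in>fixators E. length r = Suc n \<and> as = map \<pi> r" if l: "length as = Suc n" for as
  proof -
    obtain c cs where as: "as = c # cs" "length cs = n" using l by (cases as) auto
    obtain \<sigma> where \<sigma>: "\<sigma> \<in> fixators E" "\<sigma> c \<in> insert a E"
    proof (cases "c \<in> E")
      case True
      then show ?thesis using that[OF id_fixators] by simp
    next
      case False
      then show ?thesis using that[OF transpose_fixators[OF False a]] by simp
    qed
    obtain r \<pi> where r: "r \<in> R" "\<pi> \<in> fixators (insert a E)" "length r = n" "map \<sigma> cs = map \<pi> r"
      using R(2)[of "map \<sigma> cs"] as by auto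
    have "\<pi> (\<sigma> c) = \<sigma> c" using r(2) \<sigma>(2) unfolding fixators_def by blast
    with r(4) as have "map \<sigma> as = map \<pi> (\<sigma> c # r)" by simp
    then have "as = map (inv \<sigma>) (map \<pi> (\<sigma> c # r))"
      using map_inv_map[OF fixators_bij[OF \<sigma>(1)]] by metis
    then have "as = map (inv \<sigma> \<circ> \<pi>) (\<sigma> c # r)" by simp
    moreover have "inv \<sigma> \<circ> \<pi> \<in> fixators E"
      using \<sigma> r fixators_mono[of E "insert a E"] by (blast intro: fixators_comp fixators_inv)
    moreover have "\<sigma> c # r \<in> ?R" using \<sigma> r by force
    ultimately show ?thesis using r(3) by (metis length_Cons)
  qed
  moreover have "finite ?R" using Suc.prems R by blast
  ultimately show ?case by blast
qed

text \<open>The points of \<open>A\<close> are moved one at a time; the cardinality bound leaves a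
  free place in \<open>G\<close> at every step, even outside \<open>C\<close> and the earlier
  images.\<close>

lemma move_into:
  assumes "finite A" and "finite C" and "finite G" and "card A + card C \<le> card G"
  shows "\<exists>\<pi>\<in>fixators C. \<pi> ` A \<subseteq> G \<union> C"
  using assms(1,4)
proof (induction A)
  case empty
  show ?case using id_fixators by auto
next
  case (insert a A)
  then obtain \<pi> where \<pi>: "\<pi> \<in> fixators C" "\<pi> ` A \<subseteq> G \<union> C" by auto
  show ?case
  proof (cases "\<pi> a \<in> G \<union> C")
    case True
    then show ?thesis using \<pi> by blast
  next
    case False
    have "card (C \<union> \<pi> ` A) \<le> card C + card A"
      by (rule order_trans[OF card_Un_le]) (simp add: card_image_le insert.hyps)
    also have "\<dots> < card G" using insert by simp
    finally have "\<not> G \<subseteq> C \<union> \<pi> ` A"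
      using card_mono[of "C \<union> \<pi> ` A" G] insert.hyps assms by auto
    then obtain g where g: "g \<in> G" "g \<notin> C" "g \<notin> \<pi> ` A" by blast
    \<comment> \<open>Neither \<open>\<pi> a\<close> nor \<open>g\<close> lies in \<open>C\<close>
      or among the earlier images, so their transposition leaves those untouched.\<close>
    have na: "\<pi> a \<notin> \<pi> ` A"
      using insert.hyps fixators_bij[OF \<pi>(1)] by (auto dest: bij_is_inj injD)
    have "transpose (\<pi> a) g \<circ> \<pi> \<in> fixators C"
      using \<pi> g False by (intro fixators_comp transpose_fixators) auto
    moreover have "(transpose (\<pi> a) g \<circ> \<pi>) ` insert a A \<subseteq> G \<union> C"
      using \<pi>(2) g na by (auto simp: transpose_def)
    ultimately show ?thesis by blast
  qed
qed

text \<open>A priori the supports of witnesses could grow without bound as \<open>as\<close> varies.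
  Transport along an orbit does not enlarge them and there are finitely many orbits, so one finite
  set, together with the entries of \<open>as\<close>, has room for a support of some witness at
  every \<open>as\<close>.\<close>

lemma bounded_support_witness:
  assumes inf: "infinite (UNIV :: 'a set)" and E: "finite E"
    and Q: "\<And>\<pi> as d. \<pi> \<in> fixators E \<Longrightarrow> Q as d \<Longrightarrow> Q (map \<pi> as) (act \<pi> d)"
    and ex: "\<And>as :: 'a list. length as = n \<Longrightarrow> \<exists>d\<in>fs_pred m. Q as d"
  obtains E' where "finite E'" "E \<subseteq> E'"
    "\<And>as. length as = n \<Longrightarrow> \<exists>d\<in>pred m UNIV. supports (E' \<union> set as) d \<and> Q as d"
proof -
  obtain R where R: "finite R" "\<And>as :: 'a list. length as = n \<Longrightarrow>
      \<exists>r\<in>R. \<exists>\<pi>\<in>fixators E. length r = n \<and> as = map \<pi> r"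
    using finite_orbits[OF inf E, of n] by metis
  have "\<forall>r. \<exists>d F. length r = n \<longrightarrow> d \<in> pred m UNIV \<and> finite F \<and> supports F d \<and> Q r d"
    using ex unfolding fs_pred_def by blast
  then obtain d F where dF: "\<And>r. length r = n \<Longrightarrow>
      d r \<in> pred m UNIV \<and> finite (F r) \<and> supports (F r) (d r) \<and> Q r (d r)"
    by metis
  \<comment> \<open>The sum bounds the supports chosen at the representatives, and
    \<open>card E + n\<close> bounds the size of \<open>E \<union> set as\<close>: the two summands
    required by \<open>move_into\<close>.\<close>
  define N where "N = (\<Sum>r\<in>R. card (F r)) + card E + n"
  obtain G :: "'a set" where G: "finite G" "card G = N"
    using infinite_arbitrarily_large[OF inf] by blast
  show ?thesis
  proof
    show "finite (E \<union> G)" "E \<subseteq> E \<union> G" using E G by auto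
    fix as :: "'a list"
    assume "length as = n"
    with R obtain r \<pi> where r: "r \<in> R" "\<pi> \<in> fixators E" "length r = n" "as = map \<pi> r" by blast
    have fin: "finite (\<pi> ` F r)" using dF r by simp
    have "card (\<pi> ` F r) \<le> card (F r)" using dF r by (simp add: card_image_le)
    also have "\<dots> \<le> (\<Sum>r\<in>R. card (F r))" by (rule member_le_sum[OF r(1) _ R(1)]) simp
    finally have "card (\<pi> ` F r) + card (E \<union> set as) \<le> card G"
      using card_Un_le[of E "set as"] card_length[of as] \<open>length as = n\<close> unfolding G(2) N_def by linarith
    then obtain \<sigma> where \<sigma>: "\<sigma> \<in> fixators (E \<union> set as)" "\<sigma> ` \<pi> ` F r \<subseteq> G \<union> (E \<union> set as)"
      using move_into[OF fin _ G(1)] E by blast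
    have \<sigma>E: "\<sigma> \<in> fixators E" using \<sigma>(1) by (auto simp: fixators_def)
    \<comment> \<open>As \<sigma> fixes the entries of \<open>as\<close>, it moves the witness but
      not the tuple it serves.\<close>
    have "map \<sigma> as = as" using \<sigma>(1) by (simp add: fixators_def map_idI)
    then have "Q as (act \<sigma> (act \<pi> (d r)))"
      using Q[OF \<sigma>E Q[OF r(2)]] dF[OF r(3)] r(4) by metis
    moreover have "supports (E \<union> G \<union> set as) (act \<sigma> (act \<pi> (d r)))"
    proof (rule supports_mono)
      show "supports (\<sigma> ` \<pi> ` F r) (act \<sigma> (act \<pi> (d r)))"
        using dF[OF r(3)] fixators_bij[OF \<sigma>E] fixators_bij[OF r(2)] by (intro supports_act) auto
    qed (use \<sigma>(2) in blast)
    moreover have "act \<sigma> (act \<pi> (d r)) \<in> pred m UNIV"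
      using dF[OF r(3)] by (intro act_pred) auto
    ultimately show "\<exists>d\<in>pred m UNIV. supports (E \<union> G \<union> set as) d \<and> Q as d" by blast
  qed
qed

text \<open>Witnesses are chosen only at orbit representatives and carried to the rest of the orbit.
  The carrying permutation is not unique; allowing just \<open>E\<close> and the entries of the
  tuple as support is what makes the result independent of it.\<close>

lemma equivariant_selection:
  assumes E: "finite E"
    and Q: "\<And>\<pi> as d. \<pi> \<in> fixators E \<Longrightarrow> Q as d \<Longrightarrow> Q (map \<pi> as) (act \<pi> d)"
    and ex: "\<And>as. length as = n \<Longrightarrow> \<exists>d\<in>pred m UNIV. supports (E \<union> set as) d \<and> Q as d"
  shows "\<exists>s\<in>fs_pred (n + m). \<forall>as. length as = n \<longrightarrow>
    (\<exists>d\<in>fs_pred m. (\<forall>bs. length bs = m \<longrightarrow> d bs = s (as @ bs)) \<and> Q as d)"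
proof -
  obtain d where d: "\<And>as. length as = n \<Longrightarrow> d as \<in> pred m UNIV \<and> supports (E \<union> set as) (d as) \<and> Q as (d as)"
    using ex by metis
  define orb where "orb as = {map \<pi> as |\<pi>. \<pi> \<in> fixators E}" for as
  \<comment> \<open>The choice depends on the set \<open>orb as\<close> alone, so tuples of one
    orbit share their representative.\<close>
  define rep where "rep as = (SOME r. r \<in> orb as)" for as
  have "as \<in> orb as" for as
    using id_fixators[of E] unfolding orb_def by (metis (mono_tags, lifting) list.map_id mem_Collect_eq)
  then have rep_orb: "rep as \<in> orb as" for as
    unfolding rep_def by (metis someI)
  have "\<exists>\<pi>. \<pi> \<in> fixators E \<and> map \<pi> as = rep as" for as
    using rep_orb[of as] unfolding orb_def mem_Collect_eq by metis
  then obtain g where g: "\<And>as. g as \<in> fixators E" "\<And>as. map (g as) as = rep as" by metis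
  have orb_map: "orb (map \<sigma> as) = orb as" if \<sigma>: "\<sigma> \<in> fixators E" for \<sigma> as
  proof (intro equalityI subsetI)
    fix bs assume "bs \<in> orb (map \<sigma> as)"
    then obtain \<pi> where "\<pi> \<in> fixators E" "bs = map (\<pi> \<circ> \<sigma>) as" by (auto simp: orb_def)
    then show "bs \<in> orb as" using fixators_comp[OF _ \<sigma>] unfolding orb_def by blast
  next
    fix bs assume "bs \<in> orb as"
    then obtain \<pi> where \<pi>: "\<pi> \<in> fixators E" "bs = map \<pi> as" by (auto simp: orb_def)
    have "bs = map (\<pi> \<circ> inv \<sigma>) (map \<sigma> as)"
      using \<pi>(2) map_inv_map[OF fixators_bij[OF \<sigma>], of as] by (metis map_map)
    then show "bs \<in> orb (map \<sigma> as)"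
      using fixators_comp[OF \<pi>(1) fixators_inv[OF \<sigma>]] unfolding orb_def by blast
  qed
  then have rep_map: "rep (map \<sigma> as) = rep as" if "\<sigma> \<in> fixators E" for \<sigma> as
    using that by (simp add: rep_def)
  have len: "length (rep as) = length as" for as using g(2) by (metis length_map)
  \<comment> \<open>The last \<open>m\<close> entries are moved by the permutation that takes the
    first \<open>n\<close> to their representative, and are tested there.\<close>
  define s where "s = restrict (\<lambda>cs. d (rep (take n cs)) (map (g (take n cs)) (drop n cs))) (tuples (n + m) UNIV)"
  have s_eq: "s (as @ bs) = d (rep as) (map (g as) bs)" if "length as = n" "length bs = m" for as bs
    using that by (simp add: s_def tuples_def)
  have "supports E s"
    unfolding supports_def
  proof (intro ballI allI)
    fix \<sigma> cs
    assume \<sigma>: "\<sigma> \<in> fixators E"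
    show "s (map \<sigma> cs) = s cs"
    proof (cases "length cs = n + m")
      \<comment> \<open>\<open>map\<close> preserves length, so both sides are the default value
        \<open>undefined\<close> of \<open>restrict\<close>.\<close>
      case False
      then show ?thesis by (simp add: s_def tuples_def)
    next
      case True
      define as bs where "as = take n cs" and "bs = drop n cs"
      have l: "length as = n" "length bs = m" and cs: "cs = as @ bs"
        using True by (auto simp: as_def bs_def)
      \<comment> \<open>Both \<open>g (map \<sigma> as) \<circ> \<sigma>\<close> and \<open>g as\<close> send \<open>as\<close> to \<open>rep as\<close>, so they differ by a permutation
        fixing the support of \<open>d (rep as)\<close>.\<close>
      define \<tau> where "\<tau> = g (map \<sigma> as) \<circ> \<sigma> \<circ> inv (g as)"
      have \<tau>E: "\<tau> \<in> fixators E"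
        unfolding \<tau>_def using g(1) \<sigma> by (intro fixators_comp fixators_inv)
      have \<tau>_map: "map \<tau> (map (g as) xs) = map (g (map \<sigma> as)) (map \<sigma> xs)" for xs
        using map_inv_map[OF fixators_bij[OF g(1)[of as]], of xs] by (simp add: \<tau>_def flip: map_map)
      have "map \<tau> (rep as) = rep as"
        using \<tau>_map[of as] unfolding g(2) rep_map[OF \<sigma>] .
      then have "\<tau> \<in> fixators (E \<union> set (rep as))"
        using \<tau>E by (auto simp: fixators_def map_eq_conv[where g = id, simplified])
      then have "d (rep as) (map \<tau> (map (g as) bs)) = d (rep as) (map (g as) bs)"
        using d[of "rep as"] l len unfolding supports_def by metis
      then show ?thesis
        unfolding cs \<tau>_map map_append using l by (simp add: s_eq rep_map[OF \<sigma>])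
    qed
  qed
  then have "s \<in> fs_pred (n + m)" using E by (auto simp: fs_pred_def s_def restrict_in_pred)
  moreover have "\<exists>d\<in>fs_pred m. (\<forall>bs. length bs = m \<longrightarrow> d bs = s (as @ bs)) \<and> Q as d"
    if l: "length as = n" for as
  proof (intro bexI conjI allI impI)
    \<comment> \<open>The witness at \<open>as\<close> is the one at the representative, pulled back
      along \<open>g as\<close>.\<close>
    let ?h = "inv (g as)"
    have h: "?h \<in> fixators E" using g(1) by (rule fixators_inv)
    note dr = d[of "rep as", unfolded len, OF l]
    show "act ?h (d (rep as)) bs = s (as @ bs)" if "length bs = m" for bs
      using that l fixators_bij[OF g(1)[of as]] by (simp add: s_eq act_def inv_inv_eq)
    have "map ?h (rep as) = as"
      using map_inv_map[OF fixators_bij[OF g(1)]] g(2) by metis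
    then show "Q as (act ?h (d (rep as)))" using Q[OF h] dr by metis
    have "d (rep as) \<in> fs_pred m" using dr E by (auto simp: fs_pred_def intro!: exI[of _ "E \<union> set (rep as)"])
    then show "act ?h (d (rep as)) \<in> fs_pred m" using fixators_bij[OF h] by (rule act_fs_pred)
  qed
  ultimately show ?thesis by blast
qed


section \<open>The structure of finitely supported predicates\<close>

lemma fraenkel_simps: "indivs fraenkel = UNIV" "rels fraenkel = fs_pred"
  by (simp_all add: fraenkel_def)

text \<open>Only finitely many variables occur in \<open>F\<close>, so the union of their supports
  is finite. The values of individual variables are included so that \<open>fixators E\<close>
  leaves them in place.\<close>

lemma common_support:
  assumes "assignment fraenkel e P" and "wff F"
  obtains E where "finite E" "\<And>x. x \<in> ivars F \<Longrightarrow> e x \<in> E"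
    "\<And>A. A \<in> free_pvars F \<Longrightarrow> supports E (P A)"
proof -
  have "\<forall>A. \<exists>E. A \<in> free_pvars F \<longrightarrow> finite E \<and> supports E (P A)"
    using assms wff_free_pvars unfolding assignment_def fraenkel_simps fs_pred_def by blast
  then obtain S where S: "\<And>A. A \<in> free_pvars F \<Longrightarrow> finite (S A) \<and> supports (S A) (P A)"
    by metis
  show ?thesis
  proof
    show "finite (e ` ivars F \<union> (\<Union>A\<in>free_pvars F. S A))"
      using S by (simp add: finite_ivars finite_free_pvars)
    show "supports (e ` ivars F \<union> (\<Union>A\<in>free_pvars F. S A)) (P A)" if "A \<in> free_pvars F" for A
      using S[OF that] that by (blast intro: supports_mono)
  qed auto
qed

text \<open>Variables of \<open>F\<close> outside \<open>xs\<close> keep their values while the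
  tuple for \<open>xs\<close> moves. \<open>P'\<close> is kept apart from \<open>P\<close> because
  the choice argument must transport the value of \<open>D\<close>.\<close>

lemma holds_fixators:
  assumes \<pi>: "\<pi> \<in> fixators E" and e: "\<And>x. x \<in> ivars F \<Longrightarrow> e x \<in> E"
    and l: "length as = length xs"
    and P: "\<And>A. A \<in> free_pvars F \<Longrightarrow> P' A = act \<pi> (P A)"
  shows "holds fraenkel (upds e xs (map \<pi> as)) P' F \<longleftrightarrow> holds fraenkel (upds e xs as) P F"
proof (rule holds_act[where \<pi> = \<pi>])
  show "bij \<pi>" using \<pi> by (rule fixators_bij)
  then show "act \<pi> p \<in> rels fraenkel k" "act (inv \<pi>) p \<in> rels fraenkel k" if "p \<in> rels fraenkel k" for p k
    using that by (simp_all add: fraenkel_simps act_fs_pred bij_imp_bij_inv)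
  fix x assume "x \<in> ivars F"
  then have "\<pi> (e x) = e x" using \<pi> e by (auto simp: fixators_def)
  then show "upds e xs (map \<pi> as) x = \<pi> (upds e xs as x)"
    using upds_map[OF l] by (cases "x \<in> set xs") (auto simp: upds_notin)
qed (use P fraenkel_simps in auto)

text \<open>Makes each domain nonempty and later serves as the set without a well-order.\<close>

lemma True_fs_pred: "restrict (\<lambda>_. True) (tuples k UNIV) \<in> fs_pred k"
proof -
  have "supports {} (restrict (\<lambda>_. True) (tuples k UNIV))"
    by (simp add: supports_def tuples_def)
  then show ?thesis unfolding fs_pred_def using restrict_in_pred by blast
qed

text \<open>A relation defined with parameters inherits their common support, which gives
  comprehension.\<close>

lemma henkin_asser_fraenkel: "henkin_asser (fraenkel :: 'a pstruct)"
proof -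
  have "model_of (fraenkel :: 'a pstruct) comprehension"
  proof (rule model_of_comprehensionI)
    fix k :: nat and xs :: "ivar list" and G e and P :: "pvar \<Rightarrow> 'a list \<Rightarrow> bool"
    assume eP: "assignment fraenkel e P" "wff G" and l: "length xs = k"
    let ?p = "restrict (\<lambda>as. holds fraenkel (upds e xs as) P G) (tuples k UNIV)"
    obtain E where E: "finite E" "\<And>x. x \<in> ivars G \<Longrightarrow> e x \<in> E"
      "\<And>A. A \<in> free_pvars G \<Longrightarrow> supports E (P A)"
      using common_support[OF eP] by blast
    have "holds fraenkel (upds e xs (map \<pi> as)) P G = holds fraenkel (upds e xs as) P G"
      if "\<pi> \<in> fixators E" "length as = k" for \<pi> as
      by (rule holds_fixators[OF that(1)]) (use E that l supports_act_eq in fastforce)+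
    then have "supports E ?p" by (auto simp: supports_def tuples_def)
    then show "?p \<in> rels fraenkel k"
      using E by (auto simp: fraenkel_simps fs_pred_def restrict_in_pred)
  qed (simp add: fraenkel_simps)
  moreover have "predicate_structure (fraenkel :: 'a pstruct)"
  proof -
    have "(fs_pred k :: ('a list \<Rightarrow> bool) set) \<noteq> {}" "fs_pred k \<subseteq> pred k (UNIV :: 'a set)" for k
      using True_fs_pred[of k] by (auto simp: fs_pred_def simp del: restrict_apply)
    then show ?thesis by (simp add: predicate_structure_def fraenkel_simps)
  qed
  ultimately show ?thesis by (simp add: henkin_asser_def)
qed

lemma fraenkel_choice:
  assumes inf: "infinite (UNIV :: 'a set)"
  shows "model_of (fraenkel :: 'a pstruct) choice_h"
proof (rule model_of_choiceI)
  fix n m :: nat and D :: pvar and xs :: "ivar list" and H e and P :: "pvar \<Rightarrow> 'a list \<Rightarrow> bool"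
  assume eP: "assignment fraenkel e P" "wff H" and l: "length xs = n"
    and ex: "\<And>as. length as = n \<Longrightarrow> \<exists>d\<in>rels fraenkel m. holds fraenkel (upds e xs as) (P(D := d)) H"
  \<comment> \<open>The length is part of \<open>Q\<close> because \<open>holds_fixators\<close>
    transports only tuples that fit \<open>xs\<close>.\<close>
  define Q where "Q as d \<longleftrightarrow> length as = n \<and> holds fraenkel (upds e xs as) (P(D := d)) H" for as d
  obtain E where E: "finite E" "\<And>x. x \<in> ivars H \<Longrightarrow> e x \<in> E"
    "\<And>A. A \<in> free_pvars H \<Longrightarrow> supports E (P A)"
    using common_support[OF eP] by blast
  have Q: "Q (map \<pi> as) (act \<pi> d)" if \<pi>: "\<pi> \<in> fixators E" and Qd: "Q as d" for \<pi> as d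
  proof -
    have la: "length as = length xs" using Qd l by (simp add: Q_def)
    have "(P(D := act \<pi> d)) A = act \<pi> ((P(D := d)) A)" if "A \<in> free_pvars H" for A
      using supports_act_eq[OF E(3)[OF that] \<pi>] by simp
    from holds_fixators[where P = "P(D := d)" and P' = "P(D := act \<pi> d)", OF \<pi> E(2) la this] Qd show ?thesis
      by (simp add: Q_def)
  qed
  have "\<And>as. length as = n \<Longrightarrow> \<exists>d\<in>fs_pred m. Q as d"
    using ex by (simp add: fraenkel_simps Q_def)
  from bounded_support_witness[where Q = Q, OF inf E(1) Q this]
  obtain E' where E': "finite E'" "E \<subseteq> E'"
    "\<And>as. length as = n \<Longrightarrow> \<exists>d\<in>pred m UNIV. supports (E' \<union> set as) d \<and> Q as d" by blast
  \<comment> \<open>Passing to the larger \<open>E'\<close> keeps equivariance, since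
    \<open>fixators E'\<close> is contained in \<open>fixators E\<close>.\<close>
  have "Q (map \<pi> as) (act \<pi> d)" if "\<pi> \<in> fixators E'" "Q as d" for \<pi> as d
    using that Q fixators_mono[OF E'(2)] by blast
  from equivariant_selection[where Q = Q, OF E'(1) this E'(3)]
  show "\<exists>s\<in>rels fraenkel (n + m). \<forall>as. length as = n \<longrightarrow>
        (\<exists>d\<in>rels fraenkel m. (\<forall>bs. length bs = m \<longrightarrow> d bs = s (as @ bs)) \<and>
           holds fraenkel (upds e xs as) (P(D := d)) H)"
    unfolding fraenkel_simps Q_def by (simp cong: imp_cong)
qed (auto simp: fraenkel_simps fs_pred_def)

lemma not_holds_fraenkel_WO1:
  assumes inf: "infinite (UNIV :: 'a set)"
  shows "\<not> holds (fraenkel :: 'a pstruct) e P WO1"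
proof
  let ?p = "restrict (\<lambda>_. True) (tuples 1 (UNIV :: 'a set))"
  assume "holds (fraenkel :: 'a pstruct) e P WO1"
  moreover have "?p \<in> fs_pred 1" by (rule True_fs_pred)
  ultimately obtain t where t: "t \<in> fs_pred 2" "wo_on (fs_pred 1) t ?p"
    using holds_WO1[of fraenkel] unfolding fraenkel_simps by blast
  have p: "?p [a]" for a by (simp add: tuples_def)
  have tot: "t [a, b] \<or> t [b, a]" and asym: "t [a, b] \<Longrightarrow> t [b, a] \<Longrightarrow> a = b" for a b
    using t(2) p unfolding wo_on_def by metis+
  obtain E where E: "finite E" "supports E t" using t(1) by (auto simp: fs_pred_def)
  obtain a where a: "a \<notin> E" using ex_new_if_finite[OF inf E(1)] by blast
  \<comment> \<open>Avoiding \<open>a\<close> as well makes the two points distinct; the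
    transposition then forces both or neither of \<open>t [a, b]\<close> and
    \<open>t [b, a]\<close>.\<close>
  obtain b where b: "b \<notin> insert a E" using ex_new_if_finite[OF inf] E(1) by blast
  have "t (map (transpose a b) [a, b]) = t [a, b]"
    using E(2) transpose_fixators[of a E b] a b unfolding supports_def by blast
  then have "t [b, a] = t [a, b]" by simp
  then show False using tot[of a b] asym[of a b] b by auto
qed

text \<open>Over a finite type every predicate has the finite support \<open>UNIV\<close>, so
  \<open>fraenkel\<close> would offer the same predicates as \<open>full\<close>; an infinite type
  separates them.\<close>

theorem theorem5p1:
  assumes "infinite (UNIV :: 'a set)"
  shows "(\<exists>M :: 'a pstruct. henkin_asser M \<and> model_of M (choice_h \<union> {WO1}))
       \<and> (\<exists>M :: 'a pstruct. henkin_asser M \<and> model_of M (choice_h \<union> {\<^bold>\<not> WO1}))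
       \<and> \<not> follows_HPL TYPE('a) (comprehension \<union> choice_h) WO1
       \<and> \<not> follows_HPL TYPE('a) (comprehension \<union> choice_h) (\<^bold>\<not> WO1)"
proof (intro conjI exI)
  show "henkin_asser (full :: 'a pstruct)" by (rule henkin_asser_full)
  show "model_of (full :: 'a pstruct) (choice_h \<union> {WO1})"
    by (simp add: model_of_union_singleton full_choice true_in_def holds_full_WO1 del: Un_insert_right)
  show "henkin_asser (fraenkel :: 'a pstruct)" by (rule henkin_asser_fraenkel)
  show "model_of (fraenkel :: 'a pstruct) (choice_h \<union> {\<^bold>\<not> WO1})"
    using fraenkel_choice[OF assms] not_holds_fraenkel_WO1[OF assms]
    by (simp add: model_of_union_singleton true_in_def del: Un_insert_right)
  show "\<not> follows_HPL TYPE('a) (comprehension \<union> choice_h) WO1"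
    using henkin_asser_fraenkel fraenkel_choice[OF assms] not_holds_fraenkel_WO1[OF assms]
    by (rule not_follows_HPL)
  show "\<not> follows_HPL TYPE('a) (comprehension \<union> choice_h) (\<^bold>\<not> WO1)"
    using henkin_asser_full full_choice by (rule not_follows_HPL) (simp add: holds_full_WO1)
qed

end
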